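(* Let $\mathcal{A}$ be a countable alphabet, and let $X$ and $Y$ be shift spaces over $\mathcal{A}$. If $X$ is row-finite and $\phi:X\to Y$ is a sliding block code, then $\phi$ is bounded if and only if $\phi|_{X^{\mathrm{inf}}}:X^{\mathrm{inf}}\to Y^{\mathrm{inf}}$ is uniformly continuous with respect to the boundedness metrics $D$ on $X^{\mathrm{inf}}$ and $Y^{\mathrm{inf}}$.
   Context: "Countable" means finite or countably infinite; $\mathbb{N}=\{1,2,\ldots\}$. For an alphabet $\mathcal{A}$, let $\mathcal{A}^0=\{\vec{0}\}$ ($\vec{0}$ the empty sequence), $\Sigma_{\mathcal{A}}^{\mathrm{fin}}=\bigcup_{k=0}^\infty\mathcal{A}^k$ and $\Sigma_{\mathcal{A}}^{\mathrm{inf}}=\mathcal{A}^{\mathbb{N}}$; $l(x)$ is the length. If $\mathcal{A}$ is infinite, $\Sigma_{\mathcal{A}}:=\Sigma_{\mathcal{A}}^{\mathrm{inf}}\sqcup\Sigma_{\mathcal{A}}^{\mathrm{fin}}$ with the quotient topology from the map $Q:\mathcal{A}_\infty\times\mathcal{A}_\infty\times\cdots\to\Sigma_{\mathcal{A}}$ that truncates a sequence just before the first occurrence of $\infty$, where $\mathcal{A}_\infty=\mathcal{A}\cup\{\infty\}$ is the one-point compactification of the discrete space $\mathcal{A}$ and the product has the product topology. If $\mathcal{A}$ is finite, $\Sigma_{\mathcal{A}}:=\mathcal{A}^{\mathbb{N}}$ with the product topology. The shift map $\sigma$ deletes the first entry, with $\sigma(x)=\vec 0$ when $l(x)\le 1$.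 A shift space over $\mathcal{A}$ is a closed set $X\subseteq\Sigma_{\mathcal{A}}$ with $\sigma(X)\subseteq X$ having the infinite-extension property: for each $x\in X$ with $l(x)<\infty$ there are infinitely many $a\in\mathcal{A}$ with $xay\in X$ for some $y\in\Sigma_{\mathcal{A}}$. $X^{\mathrm{inf}}=X\cap\Sigma_{\mathcal{A}}^{\mathrm{inf}}$. $B(X)$ is the set of finite blocks occurring as subblocks of elements of $X$, and $B_n(X)=B(X)\cap\mathcal{A}^n$. $X$ is row-finite if for every $a\in\mathcal{A}$ the set $\{b\in\mathcal{A}:ab\in B(X)\}$ is finite. Let $X$ be row-finite. A function $\phi:X\to Y$ is a sliding block code if: (a) whenever $\{x^n\}_{n=1}^\infty\subseteq X$ and $\lim_{n\to\infty}x^n=\vec{0}$, then $\lim_{n\to\infty}\phi(x^n)=\vec{0}$; and (b) for each $a\in\mathcal{A}$ there exist $n(a)\in\mathbb{N}$ and a function $\Phi^a:B_{n(a)}(X)\cap Z(a)\to\mathcal{A}$ (where $B_n(X)\cap Z(a)$ is the set of $n$-blocks of $X$ with first entry $a$) such that $\phi(x_1x_2x_3\ldots)_i=\Phi^{x_i}(x_i\ldots x_{n(x_i)+i-1})$ for all $i\in\mathbb{N}$ and all $x_1x_2x_3\ldots\in X^{\mathrm{inf}}$. It is bounded if (the $n(a)$ can be chosen so that) there exists $M\in\mathbb{N}$ with $n(a)\le M$ for all $a\in\mathcal{A}$. The boundedness metric on $X^{\mathrm{inf}}$ is $D(x,y)=1/2^n$ if $n$ is the smallest index with $x_n\ne y_n$,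 and $D(x,y)=0$ if $x=y$; likewise on $Y^{\mathrm{inf}}$. *)

theory Defs
  imports "HOL-Analysis.Analysis" "HOL-Library.Omega_Words_Fun" "HOL-Library.Countable_Set"
begin

section \<open>Finite and infinite sequences\<close>

text \<open>Positions start at 0 here and at 1 in the mathematical text. The empty sequence is
  \<open>Fin []\<close>.\<close>

datatype 'a fiseq = Fin "'a list" | Inf (inf_of: "nat \<Rightarrow> 'a")

abbreviation empty_seq :: "'a fiseq" where
  "empty_seq \<equiv> Fin []"

definition fin_seqs :: "'a set \<Rightarrow> 'a fiseq set" where
  "fin_seqs A = Fin ` lists A"

definition inf_seqs :: "'a set \<Rightarrow> 'a fiseq set" where
  "inf_seqs A = Inf ` (UNIV \<rightarrow> A)"

primrec append_seq :: "'a list \<Rightarrow> 'a fiseq \<Rightarrow> 'a fiseq" where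
  "append_seq u (Fin v) = Fin (u @ v)"
| "append_seq u (Inf x) = Inf (u \<frown> x)"

primrec shift_map :: "'a fiseq \<Rightarrow> 'a fiseq" where
  "shift_map (Fin u) = Fin (tl u)"
| "shift_map (Inf x) = Inf (suffix 1 x)"

section \<open>The full shift\<close>

definition quotient_topology :: "'a topology \<Rightarrow> ('a \<Rightarrow> 'b) \<Rightarrow> 'b topology" where
  "quotient_topology T f =
    topology (\<lambda>U. U \<subseteq> f ` topspace T \<and> openin T {x \<in> topspace T. f x \<in> U})"

lemma openin_quotient_topology:
  "openin (quotient_topology T f) U \<longleftrightarrow>
    U \<subseteq> f ` topspace T \<and> openin T {x \<in> topspace T. f x \<in> U}"
proof -
  have "istopology (\<lambda>U. U \<subseteq> f ` topspace T \<and> openin T {x \<in> topspace T. f x \<in> U})"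
    unfolding istopology_def
  proof (intro conjI allI impI)
    fix S U
    assume "S \<subseteq> f ` topspace T \<and> openin T {x \<in> topspace T. f x \<in> S}"
      and "U \<subseteq> f ` topspace T \<and> openin T {x \<in> topspace T. f x \<in> U}"
    then have "openin T ({x \<in> topspace T. f x \<in> S} \<inter> {x \<in> topspace T. f x \<in> U})"
      by blast
    moreover have "{x \<in> topspace T. f x \<in> S} \<inter> {x \<in> topspace T. f x \<in> U} =
        {x \<in> topspace T. f x \<in> S \<inter> U}"
      by blast
    ultimately show "openin T {x \<in> topspace T. f x \<in> S \<inter> U}"
      by simp
  next
    fix K
    assume "\<forall>U\<in>K. U \<subseteq> f ` topspace T \<and> openin T {x \<in> topspace T. f x \<in> U}"
    then have "openin T (\<Union>U\<in>K. {x \<in> topspace T. f x \<in> U})"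
      by blast
    moreover have "(\<Union>U\<in>K. {x \<in> topspace T. f x \<in> U}) = {x \<in> topspace T. f x \<in> \<Union>K}"
      by blast
    ultimately show "openin T {x \<in> topspace T. f x \<in> \<Union>K}"
      by simp
  qed blast+
  then show ?thesis
    by (simp add: quotient_topology_def)
qed

lemma topspace_quotient_topology [simp]:
  "topspace (quotient_topology T f) = f ` topspace T"
proof
  show "topspace (quotient_topology T f) \<subseteq> f ` topspace T"
    using openin_topspace[of "quotient_topology T f"] by (simp only: openin_quotient_topology)
  have "{x \<in> topspace T. f x \<in> f ` topspace T} = topspace T"
    by blast
  then have "openin (quotient_topology T f) (f ` topspace T)"
    by (simp add: openin_quotient_topology)
  then show "f ` topspace T \<subseteq> topspace (quotient_topology T f)"
    by (rule openin_subset)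
qed

lemma quotient_map_quotient_topology: "quotient_map T (quotient_topology T f) f"
  by (auto simp: quotient_map_def openin_quotient_topology)

text \<open>In \<open>Alexandroff_compactification\<close> the added point \<open>\<infinity>\<close> is \<open>None\<close>.\<close>

definition trunc :: "(nat \<Rightarrow> 'a option) \<Rightarrow> 'a fiseq" where
  "trunc x = (if \<exists>i. x i = None
     then Fin (map (the \<circ> x) [0..<(LEAST i. x i = None)])
     else Inf (the \<circ> x))"

text \<open>For finite \<open>A\<close> the full shift is the product space itself; \<open>Inf\<close> only embeds it into the
  common type, and the quotient topology along this injection is the transported topology.\<close>

definition full_shift :: "'a set \<Rightarrow> 'a fiseq topology" where
  "full_shift A =
    (if finite A
     then quotient_topology (product_topology (\<lambda>_::nat. discrete_topology A) UNIV) Inf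
     else quotient_topology
       (product_topology (\<lambda>_::nat. Alexandroff_compactification (discrete_topology A)) UNIV) trunc)"

lemma homeomorphic_map_full_shift_finite:
  assumes "finite A"
  shows "homeomorphic_map (product_topology (\<lambda>_::nat. discrete_topology A) UNIV) (full_shift A) Inf"
  using assms
  by (simp add: full_shift_def homeomorphic_map_def quotient_map_quotient_topology inj_on_def)

lemma topspace_full_shift:
  "topspace (full_shift A) = (if finite A then inf_seqs A else inf_seqs A \<union> fin_seqs A)"
proof (cases "finite A")
  case True
  then show ?thesis
    by (simp add: full_shift_def inf_seqs_def PiE_UNIV_domain)
next
  case False
  have "trunc ` (UNIV \<rightarrow> insert None (Some ` A)) = inf_seqs A \<union> fin_seqs A" (is "?L = ?R")
  proof (intro equalityI subsetI)
    fix w assume "w \<in> ?L"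
    then obtain x where x: "x \<in> UNIV \<rightarrow> insert None (Some ` A)" and w: "w = trunc x"
      by blast
    have mem: "the (x i) \<in> A" if "x i \<noteq> None" for i
    proof -
      have "x i \<in> insert None (Some ` A)"
        using x by (rule Pi_mem) simp
      then show ?thesis
        using that by auto
    qed
    show "w \<in> ?R"
    proof (cases "\<exists>i. x i = None")
      case True
      have "the (x i) \<in> A" if "i < (LEAST i. x i = None)" for i
        using mem not_less_Least[OF that] by blast
      then have "set (map (the \<circ> x) [0..<(LEAST i. x i = None)]) \<subseteq> A"
        by auto
      then show ?thesis
        using True by (auto simp: w trunc_def fin_seqs_def lists_eq_set)
    next
      case False
      then show ?thesis
        using mem by (auto simp: w trunc_def inf_seqs_def)
    qed
  next
    fix w assume "w \<in> ?R"
    then show "w \<in> ?L"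
    proof
      assume "w \<in> inf_seqs A"
      then obtain x where "x \<in> UNIV \<rightarrow> A" "w = Inf x"
        by (auto simp: inf_seqs_def)
      then show ?thesis
        by (intro image_eqI[of _ _ "Some \<circ> x"]) (auto simp: trunc_def fun_eq_iff)
    next
      assume "w \<in> fin_seqs A"
      then obtain u where u: "set u \<subseteq> A" "w = Fin u"
        by (auto simp: fin_seqs_def)
      define x where "x = (\<lambda>i. if i < length u then Some (u ! i) else None)"
      have L: "(LEAST i. x i = None) = length u"
        by (rule Least_equality) (auto simp: x_def split: if_splits)
      have "map (the \<circ> x) [0..<length u] = u"
        by (rule nth_equalityI) (auto simp: x_def)
      then have "trunc x = w"
        using L u by (auto simp: trunc_def x_def)
      moreover have "x \<in> UNIV \<rightarrow> insert None (Some ` A)"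
        using u nth_mem by (fastforce simp: x_def)
      ultimately show ?thesis
        by blast
    qed
  qed
  then show ?thesis
    using False by (simp add: full_shift_def PiE_UNIV_domain)
qed

section \<open>Shift spaces\<close>

definition shift_space :: "'a set \<Rightarrow> 'a fiseq set \<Rightarrow> bool" where
  "shift_space A X \<longleftrightarrow>
    closedin (full_shift A) X \<and>
    shift_map ` X \<subseteq> X \<and>
    (\<forall>u. Fin u \<in> X \<longrightarrow>
      infinite {a \<in> A. \<exists>y \<in> topspace (full_shift A). append_seq (u @ [a]) y \<in> X})"

definition inf_part :: "'a set \<Rightarrow> 'a fiseq set \<Rightarrow> 'a fiseq set" where
  "inf_part A X = X \<inter> inf_seqs A"

definition blocks :: "'a fiseq set \<Rightarrow> 'a list set" where
  "blocks X = {u. \<exists>v y. append_seq (v @ u) y \<in> X}"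

definition nblocks :: "nat \<Rightarrow> 'a fiseq set \<Rightarrow> 'a list set" where
  "nblocks n X = {u \<in> blocks X. length u = n}"

definition row_finite :: "'a set \<Rightarrow> 'a fiseq set \<Rightarrow> bool" where
  "row_finite A X \<longleftrightarrow> (\<forall>a\<in>A. finite {b \<in> A. [a, b] \<in> blocks X})"

section \<open>Sliding block codes\<close>

text \<open>Window lengths \<open>n a\<close> and block maps \<open>\<Phi> a\<close> implementing \<open>\<phi>\<close> on infinite sequences.\<close>

definition block_rep ::
  "'a set \<Rightarrow> 'a fiseq set \<Rightarrow> ('a fiseq \<Rightarrow> 'a fiseq) \<Rightarrow> ('a \<Rightarrow> nat) \<Rightarrow> ('a \<Rightarrow> 'a list \<Rightarrow> 'a) \<Rightarrow> bool" where
  "block_rep A X \<phi> n \<Phi> \<longleftrightarrow>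
    (\<forall>a\<in>A. n a \<ge> 1 \<and> \<Phi> a \<in> {u \<in> nblocks (n a) X. hd u = a} \<rightarrow> A) \<and>
    (\<forall>x. Inf x \<in> inf_part A X \<longrightarrow>
      \<phi> (Inf x) = Inf (\<lambda>i. \<Phi> (x i) (map x [i..<i + n (x i)])))"

definition sliding_block_code ::
  "'a set \<Rightarrow> 'a fiseq set \<Rightarrow> 'a fiseq set \<Rightarrow> ('a fiseq \<Rightarrow> 'a fiseq) \<Rightarrow> bool" where
  "sliding_block_code A X Y \<phi> \<longleftrightarrow>
    \<phi> \<in> X \<rightarrow> Y \<and>
    (\<forall>x. range x \<subseteq> X \<longrightarrow> limitin (full_shift A) x empty_seq sequentially \<longrightarrow>
      limitin (full_shift A) (\<phi> \<circ> x) empty_seq sequentially) \<and>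
    (\<exists>n \<Phi>. block_rep A X \<phi> n \<Phi>)"

definition bounded_block_code :: "'a set \<Rightarrow> 'a fiseq set \<Rightarrow> ('a fiseq \<Rightarrow> 'a fiseq) \<Rightarrow> bool" where
  "bounded_block_code A X \<phi> \<longleftrightarrow> (\<exists>n \<Phi> M. block_rep A X \<phi> n \<Phi> \<and> (\<forall>a\<in>A. n a \<le> M))"

section \<open>The boundedness metric\<close>

text \<open>Meaningful on infinite sequences only. The \<open>Suc\<close> translates the least 0-based position of
  difference into the 1-based index.\<close>

definition bdist :: "'a fiseq \<Rightarrow> 'a fiseq \<Rightarrow> real" where
  "bdist x y = (if x = y then 0 else 1 / 2 ^ Suc (LEAST i. inf_of x i \<noteq> inf_of y i))"

lemma Metric_space_inf_part: "Metric_space (inf_part A X) bdist"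
proof
  fix x y z :: "'a fiseq"
  show "0 \<le> bdist x y"
    by (simp add: bdist_def)
  show "bdist x y = bdist y x"
    by (simp add: bdist_def neq_commute)
  show "bdist x y = 0 \<longleftrightarrow> x = y"
    by (simp add: bdist_def)
  assume "x \<in> inf_part A X" "y \<in> inf_part A X" "z \<in> inf_part A X"
  then have inf: "x = Inf (inf_of x)" "y = Inf (inf_of y)" "z = Inf (inf_of z)"
    by (auto simp: inf_part_def inf_seqs_def)
  show "bdist x z \<le> bdist x y + bdist y z"
  proof (cases "x = y \<or> y = z \<or> x = z")
    case True
    then show ?thesis
      by (auto simp: bdist_def)
  next
    case False
    define k where "k = (\<lambda>x y :: 'a fiseq. LEAST i. inf_of x i \<noteq> inf_of y i)"
    have "\<exists>i. inf_of x i \<noteq> inf_of z i"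
      using False inf by (metis ext)
    then have "inf_of x (k x z) \<noteq> inf_of z (k x z)"
      unfolding k_def by (rule LeastI_ex)
    then have "inf_of x (k x z) \<noteq> inf_of y (k x z) \<or> inf_of y (k x z) \<noteq> inf_of z (k x z)"
      by auto
    then have "k x y \<le> k x z \<or> k y z \<le> k x z"
      unfolding k_def by (blast intro: Least_le)
    then have "1 / 2 ^ Suc (k x z) \<le> (1 / 2 ^ Suc (k x y) :: real) \<or>
        1 / 2 ^ Suc (k x z) \<le> (1 / 2 ^ Suc (k y z) :: real)"
      by (auto intro!: divide_left_mono power_increasing simp del: power_Suc)
    moreover have "0 \<le> (1 / 2 ^ Suc (k x y) :: real)" "0 \<le> (1 / 2 ^ Suc (k y z) :: real)"
      by simp_all
    ultimately have "1 / 2 ^ Suc (k x z) \<le> (1 / 2 ^ Suc (k x y) + 1 / 2 ^ Suc (k y z) :: real)"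
      by linarith
    then show ?thesis
      using False by (simp add: bdist_def k_def)
  qed
qed

definition bmetric :: "'a set \<Rightarrow> 'a fiseq set \<Rightarrow> 'a fiseq metric" where
  "bmetric A X = metric (inf_part A X, bdist)"

lemma mspace_bmetric [simp]: "mspace (bmetric A X) = inf_part A X"
  by (simp add: bmetric_def Metric_space.mspace_metric Metric_space_inf_part)

lemma mdist_bmetric [simp]: "mdist (bmetric A X) = bdist"
  by (simp add: bmetric_def Metric_space.mdist_metric Metric_space_inf_part)

end

theory Submission
  imports Defs
begin

text \<open>Two infinite sequences are at distance less than \<open>1 / 2 ^ N\<close> exactly when their first \<open>N\<close>
  entries agree. So uniform continuity says that the first \<open>N\<close> entries of the image depend only on
  the first \<open>M\<close> entries of the argument, for some \<open>M\<close> depending on \<open>N\<close>. A bounded window length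
  gives this at once. Conversely, the case \<open>N = 1\<close> provides a window length that works at every
  position, because a sliding block code commutes with the shift.\<close>

section \<open>The boundedness metric in terms of agreement of initial entries\<close>

lemma bdist_Inf_less_iff:
  "bdist (Inf x) (Inf y) < 1 / 2 ^ N \<longleftrightarrow> (\<forall>i<N. x i = y i)"
proof (cases "x = y")
  case True
  then show ?thesis
    by (simp add: bdist_def)
next
  case False
  define k where "k = (LEAST i. x i \<noteq> y i)"
  from False have "\<exists>i. x i \<noteq> y i"
    by auto
  then have k: "x k \<noteq> y k"
    unfolding k_def by (rule LeastI_ex)
  have "bdist (Inf x) (Inf y) = 1 / 2 ^ Suc k"
    using False by (simp add: bdist_def k_def)
  also have "1 / 2 ^ Suc k < (1 / 2 ^ N :: real) \<longleftrightarrow> (2 ^ N :: real) < 2 ^ Suc k"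
    by (simp add: divide_less_eq less_divide_eq del: power_Suc)
  \<comment> \<open>The metric uses the 1-based index \<open>Suc k\<close>, so the strict inequality
    \<open>N < Suc k\<close> becomes exactly agreement at the 0-based positions below
    \<open>N\<close>.\<close>
  also have "\<dots> \<longleftrightarrow> N \<le> k"
    by (simp add: less_Suc_eq_le del: power_Suc)
  also have "N \<le> k \<longleftrightarrow> (\<forall>i<N. x i = y i)"
  proof
    assume "N \<le> k"
    then show "\<forall>i<N. x i = y i"
      using not_less_Least[of _ "\<lambda>i. x i \<noteq> y i"] unfolding k_def by (meson less_le_trans)
  next
    assume "\<forall>i<N. x i = y i"
    then show "N \<le> k"
      using k by (meson not_le)
  qed
  finally show ?thesis .
qed

lemma ex_inverse_two_power_le:
  fixes e :: real
  assumes "e > 0"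
  shows "\<exists>N. 1 / 2 ^ N \<le> e"
proof -
  obtain N where "(1 / 2) ^ N < e"
    using real_arch_pow_inv[OF assms, of "1 / 2"] by auto
  then have "1 / 2 ^ N \<le> e"
    by (simp add: power_one_over)
  then show ?thesis ..
qed

lemma inf_partE:
  assumes "w \<in> inf_part A X"
  obtains x where "w = Inf x" "Inf x \<in> inf_part A X"
  using assms by (auto simp: inf_part_def inf_seqs_def)

text \<open>The radii \<open>1 / 2 ^ N\<close> get below every positive real, so they can replace
  both epsilon and delta; closeness at these radii is agreement of prefixes.\<close>

lemma uniformly_continuous_map_bmetric_iff:
  "uniformly_continuous_map (bmetric A X) (bmetric A Y) \<phi> \<longleftrightarrow>
    \<phi> \<in> inf_part A X \<rightarrow> inf_part A Y \<and>
    (\<forall>N. \<exists>M. \<forall>x y. Inf x \<in> inf_part A X \<longrightarrow> Inf y \<in> inf_part A X \<longrightarrow> (\<forall>i<M. x i = y i) \<longrightarrow>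
      (\<forall>i<N. inf_of (\<phi> (Inf x)) i = inf_of (\<phi> (Inf y)) i))"
  (is "?L \<longleftrightarrow> ?maps \<and> ?R")
proof (cases ?maps)
  case maps: True
  \<comment> \<open>Images must be exhibited as \<open>Inf\<close> terms before the distance
    criterion applies to them.\<close>
  have image: "\<phi> (Inf x) = Inf (inf_of (\<phi> (Inf x)))" if "Inf x \<in> inf_part A X" for x
  proof -
    have "\<phi> (Inf x) \<in> inf_part A Y"
      using maps that by blast
    then show ?thesis
      by (rule inf_partE) simp
  qed
  have dist_image: "bdist (\<phi> (Inf x)) (\<phi> (Inf y)) < 1 / 2 ^ N \<longleftrightarrow>
      (\<forall>i<N. inf_of (\<phi> (Inf x)) i = inf_of (\<phi> (Inf y)) i)"
    if "Inf x \<in> inf_part A X" "Inf y \<in> inf_part A X" for x y N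
    by (subst image[OF that(1)], subst image[OF that(2)]) (rule bdist_Inf_less_iff)
  show ?thesis
  proof
    assume L: ?L
    have "\<exists>M. \<forall>x y. Inf x \<in> inf_part A X \<longrightarrow> Inf y \<in> inf_part A X \<longrightarrow> (\<forall>i<M. x i = y i) \<longrightarrow>
      (\<forall>i<N. inf_of (\<phi> (Inf x)) i = inf_of (\<phi> (Inf y)) i)" for N
    proof -
      have "(1 / 2 ^ N :: real) > 0"
        by simp
      then obtain d where "d > 0" and d: "\<And>v w. v \<in> inf_part A X \<Longrightarrow> w \<in> inf_part A X \<Longrightarrow>
          bdist w v < d \<Longrightarrow> bdist (\<phi> w) (\<phi> v) < 1 / 2 ^ N"
        using L unfolding uniformly_continuous_map_def mspace_bmetric mdist_bmetric by blast
      obtain M where "1 / 2 ^ M \<le> d"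
        using ex_inverse_two_power_le[OF \<open>d > 0\<close>] by blast
      have "bdist (\<phi> (Inf x)) (\<phi> (Inf y)) < 1 / 2 ^ N"
        if "Inf x \<in> inf_part A X" "Inf y \<in> inf_part A X" "\<forall>i<M. x i = y i" for x y
      proof -
        have "bdist (Inf x) (Inf y) < 1 / 2 ^ M"
          using that(3) by (simp only: bdist_Inf_less_iff)
        then have "bdist (Inf x) (Inf y) < d"
          using \<open>1 / 2 ^ M \<le> d\<close> by (rule less_le_trans)
        then show ?thesis
          by (rule d[OF that(2,1)])
      qed
      then show ?thesis
        using dist_image by blast
    qed
    with maps show "?maps \<and> ?R"
      by blast
  next
    assume "?maps \<and> ?R"
    then have R: ?R
      by blast
    have "\<exists>d>0. \<forall>v\<in>inf_part A X. \<forall>w\<in>inf_part A X. bdist w v < d \<longrightarrow> bdist (\<phi> w) (\<phi> v) < e"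
      if e: "e > 0" for e
    proof -
      obtain N where N: "1 / 2 ^ N \<le> e"
        using ex_inverse_two_power_le[OF e] by blast
      from R[THEN spec, of N]
      obtain M where M: "\<forall>x y. Inf x \<in> inf_part A X \<longrightarrow> Inf y \<in> inf_part A X \<longrightarrow>
          (\<forall>i<M. x i = y i) \<longrightarrow> (\<forall>i<N. inf_of (\<phi> (Inf x)) i = inf_of (\<phi> (Inf y)) i)"
        by (rule exE)
      have "bdist (\<phi> w) (\<phi> v) < e"
        if v: "v \<in> inf_part A X" and w: "w \<in> inf_part A X" and close: "bdist w v < 1 / 2 ^ M"
        for v w
      proof -
        obtain x where x: "w = Inf x" "Inf x \<in> inf_part A X"
          using w by (rule inf_partE)
        obtain y where y: "v = Inf y" "Inf y \<in> inf_part A X"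
          using v by (rule inf_partE)
        have "\<forall>i<M. x i = y i"
          using close by (simp only: x(1) y(1) bdist_Inf_less_iff)
        then have "bdist (\<phi> w) (\<phi> v) < 1 / 2 ^ N"
          unfolding x(1) y(1) dist_image[OF x(2) y(2)]
          using M x(2) y(2) by blast
        then show ?thesis
          using N by (rule less_le_trans)
      qed
      moreover have "(1 / 2 ^ M :: real) > 0"
        by simp
      ultimately show ?thesis
        by blast
    qed
    with maps show ?L
      by (simp add: uniformly_continuous_map_def)
  qed
\<comment> \<open>If \<open>?maps\<close> fails, both sides are false, since uniform continuity
  includes mapping one space into the other.\<close>
qed (simp add: uniformly_continuous_map_def)

section \<open>Sliding block codes on infinite sequences\<close>

lemma shift_space_subset:
  assumes "shift_space A X"
  shows "X \<subseteq> inf_seqs A \<union> fin_seqs A"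
  using assms closedin_subset[of "full_shift A" X]
  by (auto simp: shift_space_def topspace_full_shift split: if_splits)

lemma suffix_in_inf_part:
  assumes "shift_space A X" "Inf x \<in> inf_part A X"
  shows "Inf (suffix i x) \<in> inf_part A X"
proof -
  have "shift_map w \<in> X" if "w \<in> X" for w
    using assms(1) that by (auto simp: shift_space_def)
  then have "Inf (suffix i x) \<in> X"
  proof (induction i)
    case 0
    then show ?case
      using assms(2) by (simp add: inf_part_def)
  next
    case (Suc i)
    then have "shift_map (Inf (suffix i x)) \<in> X"
      by blast
    then show ?case
      by (simp add: suffix_def)
  qed
  then show ?thesis
    using assms(2) by (auto simp: inf_part_def inf_seqs_def suffix_def Pi_iff)
qed

lemma block_rep_apply:
  assumes "block_rep A X \<phi> n \<Phi>" "Inf x \<in> inf_part A X"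
  shows "\<phi> (Inf x) = Inf (\<lambda>i. \<Phi> (x i) (map x [i..<i + n (x i)]))"
  using assms by (simp add: block_rep_def)

text \<open>The block representation forces the image to be infinite, and membership in
  \<open>Y\<close> puts its letters in \<open>A\<close>.\<close>

lemma sliding_block_code_inf_part:
  assumes "sliding_block_code A X Y \<phi>" "shift_space A Y"
  shows "\<phi> \<in> inf_part A X \<rightarrow> inf_part A Y"
proof
  fix w assume "w \<in> inf_part A X"
  then obtain x where w: "w = Inf x" and x: "Inf x \<in> inf_part A X"
    by (rule inf_partE)
  obtain y where y: "\<phi> (Inf x) = Inf y"
    using assms(1) block_rep_apply[OF _ x] by (auto simp: sliding_block_code_def)
  moreover have "\<phi> (Inf x) \<in> Y"
    using assms(1) x by (auto simp: sliding_block_code_def inf_part_def)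
  ultimately have "Inf y \<in> Y" "Inf y \<in> inf_seqs A"
    using shift_space_subset[OF assms(2)] by (auto simp: fin_seqs_def)
  then show "\<phi> w \<in> inf_part A Y"
    by (simp add: w y inf_part_def)
qed

text \<open>The window read at position \<open>i\<close> and the map applied to it depend on the
  letters seen there, not on \<open>i\<close> itself. Hence entry 0 determines the whole
  code.\<close>

lemma block_rep_shift:
  assumes "shift_space A X" "block_rep A X \<phi> n \<Phi>" "Inf x \<in> inf_part A X"
  shows "inf_of (\<phi> (Inf x)) i = inf_of (\<phi> (Inf (suffix i x))) 0"
proof -
  have "map (suffix i x) [0..<k] = map x [i..<i + k]" for k
    by (rule nth_equalityI) (simp_all add: suffix_def)
  then show ?thesis
    using block_rep_apply[OF assms(2,3)]
      block_rep_apply[OF assms(2) suffix_in_inf_part[OF assms(1,3), of i]]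
    by simp
qed

section \<open>Bounded windows versus dependence on a prefix\<close>

text \<open>For \<open>i < N\<close> the window at \<open>i\<close> has length at most
  \<open>M\<close>, so it ends within the first \<open>N + M\<close> positions.\<close>

lemma block_rep_agree:
  assumes "block_rep A X \<phi> n \<Phi>" "\<forall>a\<in>A. n a \<le> M"
    and x: "Inf x \<in> inf_part A X" and y: "Inf y \<in> inf_part A X"
    and agree: "\<forall>i<N + M. x i = y i" and "i < N"
  shows "inf_of (\<phi> (Inf x)) i = inf_of (\<phi> (Inf y)) i"
proof -
  have "x i \<in> A"
    using x by (auto simp: inf_part_def inf_seqs_def)
  then have "n (x i) \<le> M"
    using assms(2) by blast
  then have "map x [i..<i + n (x i)] = map y [i..<i + n (x i)]"
    using agree \<open>i < N\<close> by simp
  \<comment> \<open>The letter at \<open>i\<close> selects both the window length and the block map,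
    so these coincide too.\<close>
  moreover have "y i = x i"
    using agree \<open>i < N\<close> by simp
  ultimately have "\<Phi> (x i) (map x [i..<i + n (x i)]) = \<Phi> (y i) (map y [i..<i + n (y i)])"
    by (simp only:)
  then show ?thesis
    unfolding block_rep_apply[OF assms(1) x] block_rep_apply[OF assms(1) y] fiseq.sel .
qed

text \<open>By \<open>agree\<close>, entry 0 of the image is a function of a prefix of fixed length;
  reading that function at every shift gives a representation with constant window length.\<close>

lemma bounded_block_code_if_agree:
  assumes "shift_space A X" "shift_space A Y" "sliding_block_code A X Y \<phi>"
    and agree: "\<And>x y. Inf x \<in> inf_part A X \<Longrightarrow> Inf y \<in> inf_part A X \<Longrightarrow> \<forall>i<M. x i = y i \<Longrightarrow>
      inf_of (\<phi> (Inf x)) 0 = inf_of (\<phi> (Inf y)) 0"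
  shows "bounded_block_code A X \<phi>"
proof -
  obtain n0 \<Phi>0 where rep: "block_rep A X \<phi> n0 \<Phi>0"
    using assms(3) by (auto simp: sliding_block_code_def)
  \<comment> \<open>Window lengths must be at least 1, while \<open>M\<close> may be 0.\<close>
  define m where "m = Suc M"
  define P where "P = (\<lambda>u x. Inf x \<in> inf_part A X \<and> map x [0..<m] = u)"
  \<comment> \<open>A block of \<open>X\<close> may fail to extend to an infinite sequence in \<open>X\<close>; the value \<open>a\<close> on such
    blocks is arbitrary.\<close>
  define \<Phi> where
    "\<Phi> = (\<lambda>a u. if \<exists>x. P u x then inf_of (\<phi> (Inf (SOME x. P u x))) 0 else a)"
  have in_A: "inf_of (\<phi> (Inf x)) i \<in> A" if "Inf x \<in> inf_part A X" for x i
  proof -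
    have "\<phi> (Inf x) \<in> inf_part A Y"
      using sliding_block_code_inf_part[OF assms(3,2)] that by blast
    then show ?thesis
      by (auto simp: inf_part_def inf_seqs_def)
  qed
  \<comment> \<open>Values in \<open>A\<close> are required on all blocks of \<open>X\<close>
    starting with \<open>a\<close>, including those where the default \<open>a\<close> is
    taken.\<close>
  have \<Phi>_in: "\<Phi> a u \<in> A" if "a \<in> A" for a u
  proof (cases "\<exists>x. P u x")
    case True
    then have "P u (SOME x. P u x)"
      by (rule someI_ex)
    with True show ?thesis
      by (simp add: \<Phi>_def P_def in_A)
  qed (auto simp: \<Phi>_def that)
  have \<Phi>_eq: "\<Phi> a (map x [0..<m]) = inf_of (\<phi> (Inf x)) 0" if x: "Inf x \<in> inf_part A X" for a x
  proof -
    define z where "z = (SOME z. P (map x [0..<m]) z)"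
    have ex: "\<exists>z. P (map x [0..<m]) z"
      using x by (auto simp: P_def)
    then have "P (map x [0..<m]) z"
      unfolding z_def by (rule someI_ex)
    then have "Inf z \<in> inf_part A X" "\<forall>i<M. z i = x i"
      by (auto simp: P_def m_def)
    \<comment> \<open>The chosen extension \<open>z\<close> need not be \<open>x\<close>, but the
      common prefix makes the choice irrelevant.\<close>
    then have "inf_of (\<phi> (Inf z)) 0 = inf_of (\<phi> (Inf x)) 0"
      using agree x by blast
    moreover have "\<Phi> a (map x [0..<m]) = inf_of (\<phi> (Inf z)) 0"
      unfolding \<Phi>_def z_def using ex by (rule if_P)
    ultimately show ?thesis
      by simp
  qed
  have "block_rep A X \<phi> (\<lambda>_. m) \<Phi>"
    unfolding block_rep_def
  proof (intro conjI ballI allI impI)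
    fix x assume x: "Inf x \<in> inf_part A X"
    have "inf_of (\<phi> (Inf x)) i = \<Phi> (x i) (map x [i..<i + m])" for i
    proof -
      have "map (suffix i x) [0..<m] = map x [i..<i + m]"
        by (rule nth_equalityI) (simp_all add: suffix_def)
      then show ?thesis
        using block_rep_shift[OF assms(1) rep x, of i]
          \<Phi>_eq[OF suffix_in_inf_part[OF assms(1) x, of i], of "x i"]
        by simp
    qed
    moreover have "\<phi> (Inf x) = Inf (inf_of (\<phi> (Inf x)))"
      using block_rep_apply[OF rep x] by simp
    ultimately show "\<phi> (Inf x) = Inf (\<lambda>i. \<Phi> (x i) (map x [i..<i + m]))"
      by presburger
  qed (auto simp: m_def \<Phi>_in)
  then show ?thesis
    unfolding bounded_block_code_def by blast
qed

theorem proposition7p13: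
  fixes A :: "'a set" and X Y :: "'a fiseq set" and \<phi> :: "'a fiseq \<Rightarrow> 'a fiseq"
  assumes "countable A"
    and "shift_space A X"
    and "shift_space A Y"
    and "row_finite A X"
    and "sliding_block_code A X Y \<phi>"
  shows "bounded_block_code A X \<phi> \<longleftrightarrow>
    uniformly_continuous_map (bmetric A X) (bmetric A Y) \<phi>"
proof
  assume "bounded_block_code A X \<phi>"
  then obtain n \<Phi> M where rep: "block_rep A X \<phi> n \<Phi>" "\<forall>a\<in>A. n a \<le> M"
    by (auto simp: bounded_block_code_def)
  show "uniformly_continuous_map (bmetric A X) (bmetric A Y) \<phi>"
    unfolding uniformly_continuous_map_bmetric_iff
  proof (intro conjI allI sliding_block_code_inf_part[OF assms(5,3)])
    fix N
    show "\<exists>M. \<forall>x y. Inf x \<in> inf_part A X \<longrightarrow> Inf y \<in> inf_part A X \<longrightarrow> (\<forall>i<M. x i = y i) \<longrightarrow>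
        (\<forall>i<N. inf_of (\<phi> (Inf x)) i = inf_of (\<phi> (Inf y)) i)"
      by (rule exI[of _ "N + M"]) (intro allI impI, rule block_rep_agree[OF rep])
  qed
next
  assume "uniformly_continuous_map (bmetric A X) (bmetric A Y) \<phi>"
  from this[unfolded uniformly_continuous_map_bmetric_iff, THEN conjunct2, THEN spec, of 1]
  obtain M where M: "\<forall>x y. Inf x \<in> inf_part A X \<longrightarrow> Inf y \<in> inf_part A X \<longrightarrow>
      (\<forall>i<M. x i = y i) \<longrightarrow> (\<forall>i<1. inf_of (\<phi> (Inf x)) i = inf_of (\<phi> (Inf y)) i)"
    by (rule exE)
  show "bounded_block_code A X \<phi>"
  proof (rule bounded_block_code_if_agree[OF assms(2,3,5)])
    fix x y assume "Inf x \<in> inf_part A X" "Inf y \<in> inf_part A X" "\<forall>i<M. x i = y i"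
    with M show "inf_of (\<phi> (Inf x)) 0 = inf_of (\<phi> (Inf y)) 0"
      using zero_less_one by blast
  qed
qed

end
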